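(* Let $R$ be an associative ring with unity. Then $R$ is inner McCoy if and only if the polynomial ring $R[x]$ is inner McCoy.
   Context: All rings are associative with unity. For a ring $A$, $A[y]$ denotes the polynomial ring in an indeterminate $y$ commuting with $A$. A ring $A$ is inner McCoy if for every pair $f(y), g(y) \in A[y]\setminus\{0\}$ with $f(y)g(y)f(y) = 0$ there exists $r \in A\setminus\{0\}$ such that $f(y)\, r\, f(y) = 0$. *)

theory Defs
  imports "HOL-Algebra.UnivPoly"
begin

text \<open>
  The polynomial ring \<open>A[y]\<close> is the library's \<^const>\<open>UP\<close>, which is a ring for every (not
  necessarily commutative) unital ring \<open>A\<close>, with \<open>y\<close> commuting with the coefficients.
  In \<open>f(y) r f(y)\<close> the element \<open>r\<close> of \<open>A\<close> is read as the constant polynomial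
  \<open>monom (UP A) r 0\<close>.
\<close>

definition inner_McCoy :: "('a, 'm) ring_scheme \<Rightarrow> bool" where
  "inner_McCoy A \<longleftrightarrow>
    (\<forall>f \<in> carrier (UP A) - {\<zero>\<^bsub>UP A\<^esub>}. \<forall>g \<in> carrier (UP A) - {\<zero>\<^bsub>UP A\<^esub>}.
      f \<otimes>\<^bsub>UP A\<^esub> g \<otimes>\<^bsub>UP A\<^esub> f = \<zero>\<^bsub>UP A\<^esub> \<longrightarrow>
      (\<exists>r \<in> carrier A - {\<zero>\<^bsub>A\<^esub>}.
        f \<otimes>\<^bsub>UP A\<^esub> monom (UP A) r 0 \<otimes>\<^bsub>UP A\<^esub> f = \<zero>\<^bsub>UP A\<^esub>))"

end

theory Submission
  imports Defs
begin

text \<open>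
  Two translations between \<open>R[y]\<close> and \<open>R[x][y]\<close> carry a relation \<open>f g f = 0\<close> in one ring to such
  a relation in the other one, and carry a constant that witnesses the inner McCoy property back.

  Suppose that \<open>R\<close> is inner McCoy and \<open>F G F = 0\<close> in \<open>R[x][y]\<close>. Since \<open>x\<^sup>k\<close> is central in \<open>R[x]\<close>,
  the substitution \<open>y \<mapsto> x\<^sup>k\<close> is multiplicative (\<open>eval_central_mult\<close>). If \<open>k\<close> exceeds the
  degrees in \<open>x\<close> that occur in \<open>F\<close>, \<open>G\<close> and \<open>F r F\<close> with \<open>r \<in> R\<close>, then different powers of \<open>y\<close> go
  to disjoint blocks of powers of \<open>x\<close>, so none of these polynomials is lost
  (\<open>Kronecker_substitution_eq_zero\<close>). Hence the images of \<open>F\<close> and \<open>G\<close> are nonzero elements of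
  \<open>R[x]\<close>, the hypothesis on \<open>R\<close> gives \<open>r \<noteq> 0\<close> with \<open>F(x\<^sup>k) r F(x\<^sup>k) = 0\<close>, and this implies
  \<open>F r F = 0\<close>.

  Suppose that \<open>R[x]\<close> is inner McCoy and \<open>f g f = 0\<close> in \<open>R[y]\<close>. Read \<open>f\<close> and \<open>g\<close> as elements of
  \<open>R[x][y]\<close> whose coefficients are constant in \<open>x\<close>. There is then a nonzero \<open>r \<in> R[x]\<close> with
  \<open>f r f = 0\<close>. Since \<open>f\<close> does not involve \<open>x\<close>, comparing coefficients of \<open>x\<^sup>m\<close> gives
  \<open>f r\<^sub>m f = 0\<close> for every coefficient \<open>r\<^sub>m\<close> of \<open>r\<close> (\<open>x_coeff_embed_mult\<close>,
  \<open>x_coeff_mult_embed\<close>), and one of these is nonzero.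
\<close>

section \<open>Evaluation at a central element\<close>

context UP_ring
begin

lemma coeff_mult_monom:
  assumes p: "p \<in> carrier P" and c: "c \<in> carrier R"
  shows "coeff P (p \<otimes>\<^bsub>P\<^esub> monom P c k) d = (if k \<le> d then coeff P p (d - k) \<otimes> c else \<zero>)"
proof -
  have "coeff P (p \<otimes>\<^bsub>P\<^esub> monom P c k) d
      = (\<Oplus>i\<in>{..d}. coeff P p i \<otimes> (if k = d - i then c else \<zero>))"
    using p c by (simp cong: R.finsum_cong)
  also have "\<dots> = (if k \<le> d then coeff P p (d - k) \<otimes> c else \<zero>)"
  proof (cases "k \<le> d")
    case True
    have "(\<Oplus>i\<in>{..d}. coeff P p i \<otimes> (if k = d - i then c else \<zero>))
        = (\<Oplus>i\<in>{..d}. if d - k = i then coeff P p i \<otimes> c else \<zero>)"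
      using True p c by (intro R.finsum_cong') (auto simp: Pi_def)
    also have "\<dots> = coeff P p (d - k) \<otimes> c"
      using p c by (intro R.finsum_singleton) (auto simp: Pi_def)
    finally show ?thesis using True by simp
  next
    case False
    have "(\<Oplus>i\<in>{..d}. coeff P p i \<otimes> (if k = d - i then c else \<zero>)) = (\<Oplus>i\<in>{..d}. \<zero>)"
      using False p c by (intro R.finsum_cong') (auto simp: Pi_def)
    then show ?thesis using False by simp
  qed
  finally show ?thesis .
qed

lemma monom_one_central:
  assumes p: "p \<in> carrier P"
  shows "p \<otimes>\<^bsub>P\<^esub> monom P \<one> k = monom P \<one> k \<otimes>\<^bsub>P\<^esub> p"
proof (rule up_eqI)
  fix d
  have *: "coeff P (monom P \<one> k \<otimes>\<^bsub>P\<^esub> p) d = (if k \<le> d then coeff P p (d - k) else \<zero>)"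
  proof (cases "k \<le> d")
    case True
    have "coeff P (monom P \<one> k \<otimes>\<^bsub>P\<^esub> p) ((d - k) + k) = \<one> \<otimes> coeff P p (d - k)"
      by (rule coeff_monom_mult[OF R.one_closed p])
    then show ?thesis using True p by simp
  next
    case False
    have "coeff P (monom P \<one> k \<otimes>\<^bsub>P\<^esub> p) d = (\<Oplus>i\<in>{..d}. \<zero>)"
      unfolding coeff_mult[OF monom_closed[OF R.one_closed] p]
      using False p by (intro R.finsum_cong') (auto simp: Pi_def)
    then show ?thesis using False by simp
  qed
  show "coeff P (p \<otimes>\<^bsub>P\<^esub> monom P \<one> k) d = coeff P (monom P \<one> k \<otimes>\<^bsub>P\<^esub> p) d"
    unfolding * coeff_mult_monom[OF p R.one_closed] using p by simp
qed (use p in simp_all)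

lemma monom_one_pow: "monom P \<one> k [^]\<^bsub>P\<^esub> (i::nat) = monom P \<one> (k * i)"
proof (induction i)
  case (Suc i)
  have "monom P \<one> k [^]\<^bsub>P\<^esub> Suc i = monom P (\<one> \<otimes> \<one>) (k * i + k)"
    by (simp add: Suc.IH monom_mult[symmetric] del: monom_mult R.l_one R.r_one)
  then show ?case by (simp add: add.commute)
qed simp

text \<open>
  Every coefficient of \<open>q\<close> can be moved past the powers of \<open>s\<close> that belong to \<open>p\<close>, so the double sum
  is a Cauchy product. Centrality of \<open>s\<close> takes the place of commutativity of the ring.
\<close>

lemma eval_central_mult:
  assumes s: "s \<in> carrier R" and central: "\<And>a. a \<in> carrier R \<Longrightarrow> a \<otimes> s = s \<otimes> a"
    and p: "p \<in> carrier P" and q: "q \<in> carrier P"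
  shows "eval R R (\<lambda>a. a) s (p \<otimes>\<^bsub>P\<^esub> q) = eval R R (\<lambda>a. a) s p \<otimes> eval R R (\<lambda>a. a) s q"
proof -
  have pow_central: "s [^] i \<otimes> a = a \<otimes> s [^] i" if a: "a \<in> carrier R" for a and i :: nat
  proof (induction i)
    case (Suc i)
    have "s [^] Suc i \<otimes> a = s [^] i \<otimes> (a \<otimes> s)"
      using a s by (simp add: R.m_assoc central[OF a])
    also have "\<dots> = a \<otimes> s [^] Suc i"
      using a s Suc.IH by (simp add: R.m_assoc[symmetric])
    finally show ?case .
  qed (use a in simp)
  have rearrange: "a \<otimes> b \<otimes> s [^] j = (a \<otimes> s [^] i) \<otimes> (b \<otimes> s [^] (j - i))"
    if "a \<in> carrier R" "b \<in> carrier R" "i \<le> j" for a b and i j :: nat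
  proof -
    have "(a \<otimes> s [^] i) \<otimes> (b \<otimes> s [^] (j - i)) = a \<otimes> (s [^] i \<otimes> b) \<otimes> s [^] (j - i)"
      using that s by (simp add: R.m_assoc)
    also have "\<dots> = a \<otimes> (b \<otimes> s [^] i) \<otimes> s [^] (j - i)"
      by (simp only: pow_central[OF that(2)])
    also have "\<dots> = a \<otimes> b \<otimes> (s [^] i \<otimes> s [^] (j - i))"
      using that s by (simp add: R.m_assoc)
    finally show ?thesis using that s by (simp add: R.nat_pow_mult)
  qed
  let ?t = "\<lambda>u i. coeff P u i \<otimes> s [^] i"
  have "eval R R (\<lambda>a. a) s (p \<otimes>\<^bsub>P\<^esub> q) = (\<Oplus>i\<in>{..deg R (p \<otimes>\<^bsub>P\<^esub> q)}. ?t (p \<otimes>\<^bsub>P\<^esub> q) i)"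
    using p q by (simp only: eval_on_carrier UP_mult_closed)
  also have "\<dots> = (\<Oplus>i\<in>{..deg R p + deg R q}. ?t (p \<otimes>\<^bsub>P\<^esub> q) i)"
    using p q s deg_mult_ring[OF p q]
    by (intro R.add.finprod_mono_neutral_cong_left) (auto simp: deg_aboveD simp del: coeff_mult)
  also have "\<dots> = (\<Oplus>j\<in>{..deg R p + deg R q}. \<Oplus>i\<in>{..j}. ?t p i \<otimes> ?t q (j - i))"
  proof (intro R.finsum_cong')
    fix j
    have "?t (p \<otimes>\<^bsub>P\<^esub> q) j = (\<Oplus>i\<in>{..j}. coeff P p i \<otimes> coeff P q (j - i) \<otimes> s [^] j)"
      using p q s by (simp add: R.finsum_ldistr Pi_def)
    also have "\<dots> = (\<Oplus>i\<in>{..j}. ?t p i \<otimes> ?t q (j - i))"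
      using p q s by (intro R.finsum_cong' refl rearrange) simp_all
    finally show "?t (p \<otimes>\<^bsub>P\<^esub> q) j = (\<Oplus>i\<in>{..j}. ?t p i \<otimes> ?t q (j - i))" .
  qed (use p q s in \<open>auto simp: Pi_def\<close>)
  also have "\<dots> = (\<Oplus>i\<in>{..deg R p}. ?t p i) \<otimes> (\<Oplus>i\<in>{..deg R q}. ?t q i)"
    using p q s by (intro R.cauchy_product) (auto simp: Pi_def bound_def deg_aboveD)
  finally show ?thesis
    using p q by (simp only: eval_on_carrier)
qed

lemma eval_constant:
  assumes "s \<in> carrier R" and "r \<in> carrier R"
  shows "eval R R (\<lambda>a. a) s (monom P r 0) = r"
  using assms by (simp only: eval_on_carrier monom_closed) simp

lemma eval_in_carrier:
  assumes "s \<in> carrier R" and "p \<in> carrier P"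
  shows "eval R R (\<lambda>a. a) s p \<in> carrier R"
  using assms by (simp only: eval_on_carrier) (simp add: Pi_def)

lemma inner_McCoyE:
  assumes "inner_McCoy R" and "f \<in> carrier P - {\<zero>\<^bsub>P\<^esub>}" and "g \<in> carrier P - {\<zero>\<^bsub>P\<^esub>}"
    and "f \<otimes>\<^bsub>P\<^esub> g \<otimes>\<^bsub>P\<^esub> f = \<zero>\<^bsub>P\<^esub>"
  obtains r where "r \<in> carrier R" "r \<noteq> \<zero>" "f \<otimes>\<^bsub>P\<^esub> monom P r 0 \<otimes>\<^bsub>P\<^esub> f = \<zero>\<^bsub>P\<^esub>"
  using assms unfolding inner_McCoy_def P_def[symmetric] by blast

end

section \<open>Polynomials in two indeterminates\<close>

text \<open>In this locale \<open>P\<close> is read as \<open>R[x]\<close> and \<open>Q\<close> as \<open>R[x][y]\<close>.\<close>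

locale UP_UP_ring = UP_ring +
  fixes Q (structure)
  defines Q_def: "Q \<equiv> UP P"

sublocale UP_UP_ring < Q: UP_ring P Q
  by unfold_locales

context UP_UP_ring
begin

subsection \<open>Substituting a high power of \<open>x\<close> for \<open>y\<close>\<close>

definition x_deg_le :: "nat \<Rightarrow> (nat \<Rightarrow> nat \<Rightarrow> 'a) \<Rightarrow> bool"
  where "x_deg_le b F \<longleftrightarrow> (\<forall>n. deg R (coeff Q F n) \<le> b)"

lemma x_deg_le_exists:
  assumes F: "F \<in> carrier Q"
  shows "\<exists>b. x_deg_le b F"
proof -
  have "deg R (coeff Q F n) \<le> (\<Sum>i\<le>deg P F. deg R (coeff Q F i))" for n
  proof (cases "n \<le> deg P F")
    case True
    then show ?thesis by (intro member_le_sum) auto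
  next
    case False
    then show ?thesis using F by (simp add: Q.deg_aboveD)
  qed
  then show ?thesis unfolding x_deg_le_def by blast
qed

lemma x_deg_le_mult:
  assumes F: "F \<in> carrier Q" "x_deg_le a F" and G: "G \<in> carrier Q" "x_deg_le b G"
  shows "x_deg_le (a + b) (F \<otimes>\<^bsub>Q\<^esub> G)"
  unfolding x_deg_le_def
proof
  fix n
  show "deg R (coeff Q (F \<otimes>\<^bsub>Q\<^esub> G) n) \<le> a + b"
  proof (rule deg_aboveI)
    fix m assume m: "a + b < m"
    have "coeff P (coeff Q F i \<otimes>\<^bsub>P\<^esub> coeff Q G j) m = \<zero>" for i j
    proof -
      have "deg R (coeff Q F i \<otimes>\<^bsub>P\<^esub> coeff Q G j) \<le> deg R (coeff Q F i) + deg R (coeff Q G j)"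
        using F(1) G(1) by (intro deg_mult_ring) simp_all
      also have "\<dots> \<le> a + b"
        using F(2) G(2) unfolding x_deg_le_def by (intro add_mono) auto
      finally show ?thesis using m F(1) G(1) by (intro deg_aboveD) simp_all
    qed
    then show "coeff P (coeff Q (F \<otimes>\<^bsub>Q\<^esub> G) n) m = \<zero>"
      using F(1) G(1) by (simp add: coeff_finsum Pi_def del: coeff_mult)
  qed (use F(1) G(1) in simp)
qed

abbreviation Kronecker_substitution :: "nat \<Rightarrow> (nat \<Rightarrow> nat \<Rightarrow> 'a) \<Rightarrow> nat \<Rightarrow> 'a"
  where "Kronecker_substitution k \<equiv> eval P P (\<lambda>a. a) (monom P \<one> k)"

text \<open>
  The term \<open>F\<^sub>n y\<^sup>n\<close> occupies only powers \<open>x\<^sup>d\<close> with \<open>k n \<le> d < k (n + 1)\<close> after the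
  substitution, so no cancellation between different \<open>n\<close> is possible.
\<close>

lemma Kronecker_substitution_eq_zero:
  assumes F: "F \<in> carrier Q" and deg: "x_deg_le b F" and k: "b < k"
    and zero: "Kronecker_substitution k F = \<zero>\<^bsub>P\<^esub>"
  shows "F = \<zero>\<^bsub>Q\<^esub>"
proof (rule Q.up_eqI)
  fix n
  have "coeff P (coeff Q F n) m = \<zero>" if n: "n \<le> deg P F" for m
  proof (cases "m \<le> b")
    case True
    let ?d = "k * n + m"
    have other: "coeff P (coeff Q F i \<otimes>\<^bsub>P\<^esub> monom P \<one> (k * i)) ?d
        = (if n = i then coeff P (coeff Q F i) m else \<zero>)" for i
    proof (cases n i rule: linorder_cases)
      case less
      have "k * Suc n \<le> k * i" using less by (intro mult_le_mono) auto
      then have "?d < k * i" using True k by simp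
      then show ?thesis using less F by (simp add: coeff_mult_monom del: coeff_mult)
    next
      case equal
      then show ?thesis using F by (simp add: coeff_mult_monom del: coeff_mult)
    next
      case greater
      have "k * Suc i \<le> k * n" using greater by (intro mult_le_mono) auto
      then have "k * i \<le> ?d" and "b < ?d - k * i" using k by auto
      moreover have "deg R (coeff Q F i) \<le> b" using deg by (simp add: x_deg_le_def)
      ultimately have "coeff P (coeff Q F i) (?d - k * i) = \<zero>"
        using F by (intro deg_aboveD) simp_all
      then show ?thesis
        using greater F \<open>k * i \<le> ?d\<close> by (simp add: coeff_mult_monom del: coeff_mult)
    qed
    have "\<zero> = coeff P (Kronecker_substitution k F) ?d"
      by (simp add: zero)
    also have "\<dots> = (\<Oplus>i\<in>{..deg P F}. coeff P (coeff Q F i \<otimes>\<^bsub>P\<^esub> monom P \<one> (k * i)) ?d)"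
      using F
      by (simp only: Q.eval_on_carrier monom_one_pow) (simp add: coeff_finsum Pi_def del: coeff_mult)
    also have "\<dots> = (\<Oplus>i\<in>{..deg P F}. if n = i then coeff P (coeff Q F i) m else \<zero>)"
      by (simp only: other)
    also have "\<dots> = coeff P (coeff Q F n) m"
      using n F by (intro R.finsum_singleton) (auto simp: Pi_def)
    finally show ?thesis by simp
  next
    case False
    moreover have "deg R (coeff Q F n) \<le> b" using deg by (simp add: x_deg_le_def)
    ultimately show ?thesis using F by (intro deg_aboveD) simp_all
  qed
  then have "coeff Q F n = \<zero>\<^bsub>P\<^esub>" if "n \<le> deg P F"
    using that F by (intro up_eqI) simp_all
  then show "coeff Q F n = coeff Q \<zero>\<^bsub>Q\<^esub> n"
    using F by (cases "n \<le> deg P F") (simp_all add: Q.deg_aboveD)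
qed (use F in simp_all)

theorem inner_McCoy_UP_if_inner_McCoy:
  assumes "inner_McCoy R"
  shows "inner_McCoy P"
  unfolding inner_McCoy_def Q_def[symmetric]
proof (intro ballI impI)
  fix F G
  assume "F \<in> carrier Q - {\<zero>\<^bsub>Q\<^esub>}" and "G \<in> carrier Q - {\<zero>\<^bsub>Q\<^esub>}"
  then have F: "F \<in> carrier Q" "F \<noteq> \<zero>\<^bsub>Q\<^esub>" and G: "G \<in> carrier Q" "G \<noteq> \<zero>\<^bsub>Q\<^esub>"
    by auto
  assume FGF: "F \<otimes>\<^bsub>Q\<^esub> G \<otimes>\<^bsub>Q\<^esub> F = \<zero>\<^bsub>Q\<^esub>"
  obtain a b where a: "x_deg_le a F" and b: "x_deg_le b G"
    using x_deg_le_exists F(1) G(1) by metis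
  \<comment> \<open>Beyond \<open>a\<close> and \<open>b\<close>, the number \<open>k\<close> must exceed \<open>a + a\<close>, the bound for \<open>F r F\<close>.\<close>
  define k where "k = Suc (a + a + b)"
  let ?s = "Kronecker_substitution k"
  have s_mult: "?s (H \<otimes>\<^bsub>Q\<^esub> K) = ?s H \<otimes>\<^bsub>P\<^esub> ?s K" if "H \<in> carrier Q" "K \<in> carrier Q" for H K
    using that by (intro Q.eval_central_mult monom_one_central) simp_all
  have s_const: "?s (monom Q r 0) = r" if "r \<in> carrier P" for r
    using that by (intro Q.eval_constant) simp_all
  have "?s F \<in> carrier P - {\<zero>\<^bsub>P\<^esub>}"
    using F Kronecker_substitution_eq_zero[OF F(1) a, of k]
    by (auto simp: k_def intro!: Q.eval_in_carrier)
  moreover have "?s G \<in> carrier P - {\<zero>\<^bsub>P\<^esub>}"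
    using G Kronecker_substitution_eq_zero[OF G(1) b, of k]
    by (auto simp: k_def intro!: Q.eval_in_carrier)
  moreover have "?s F \<otimes>\<^bsub>P\<^esub> ?s G \<otimes>\<^bsub>P\<^esub> ?s F = \<zero>\<^bsub>P\<^esub>"
  proof -
    have "?s F \<otimes>\<^bsub>P\<^esub> ?s G \<otimes>\<^bsub>P\<^esub> ?s F = ?s (monom Q \<zero>\<^bsub>P\<^esub> 0)"
      using F(1) G(1) by (simp add: s_mult[symmetric] FGF)
    then show ?thesis by (simp only: s_const UP_zero_closed)
  qed
  ultimately obtain r where r: "r \<in> carrier R" "r \<noteq> \<zero>"
    and FrF: "?s F \<otimes>\<^bsub>P\<^esub> monom P r 0 \<otimes>\<^bsub>P\<^esub> ?s F = \<zero>\<^bsub>P\<^esub>"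
    by (rule inner_McCoyE[OF assms])
  let ?c = "monom Q (monom P r 0) 0"
  have c: "?c \<in> carrier Q" using r by simp
  have "x_deg_le 0 ?c"
    using r unfolding x_deg_le_def by simp
  then have "x_deg_le (a + 0 + a) (F \<otimes>\<^bsub>Q\<^esub> ?c \<otimes>\<^bsub>Q\<^esub> F)"
    using F(1) c a by (intro x_deg_le_mult Q.UP_mult_closed)
  moreover have "?s (F \<otimes>\<^bsub>Q\<^esub> ?c \<otimes>\<^bsub>Q\<^esub> F) = \<zero>\<^bsub>P\<^esub>"
    using F(1) c r FrF by (simp add: s_mult s_const)
  ultimately have "F \<otimes>\<^bsub>Q\<^esub> ?c \<otimes>\<^bsub>Q\<^esub> F = \<zero>\<^bsub>Q\<^esub>"
    using F(1) c by (intro Kronecker_substitution_eq_zero[where b = "a + 0 + a" and k = k])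
      (simp_all add: k_def)
  moreover have "monom P r 0 \<in> carrier P - {\<zero>\<^bsub>P\<^esub>}"
    using r by (metis DiffI coeff_monom coeff_zero monom_closed singletonD)
  ultimately show "\<exists>r\<in>carrier P - {\<zero>\<^bsub>P\<^esub>}. F \<otimes>\<^bsub>Q\<^esub> monom Q r 0 \<otimes>\<^bsub>Q\<^esub> F = \<zero>\<^bsub>Q\<^esub>"
    by blast
qed

subsection \<open>Comparing coefficients of powers of \<open>x\<close>\<close>

text \<open>
  The embedding of \<open>R[y]\<close> into \<open>R[x][y]\<close>, with coefficients constant in \<open>x\<close>. The polynomials
  that \<open>embed\<close> takes and \<open>x_coeff\<close> returns have the indeterminate \<open>y\<close>: the same \<open>P\<close> is read as
  \<open>R[y]\<close> there.
\<close>

definition embed :: "(nat \<Rightarrow> 'a) \<Rightarrow> nat \<Rightarrow> nat \<Rightarrow> 'a"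
  where "embed f = (\<lambda>n. monom P (coeff P f n) 0)"

text \<open>The coefficient of \<open>x\<^sup>m\<close>, as a polynomial in \<open>y\<close>.\<close>

definition x_coeff :: "nat \<Rightarrow> (nat \<Rightarrow> nat \<Rightarrow> 'a) \<Rightarrow> nat \<Rightarrow> 'a"
  where "x_coeff m F = (\<lambda>n. coeff P (coeff Q F n) m)"

lemma
  assumes f: "f \<in> carrier P"
  shows embed_closed: "embed f \<in> carrier Q"
    and coeff_embed: "coeff Q (embed f) n = monom P (coeff P f n) 0"
proof -
  have "embed f \<in> up P"
  proof (rule mem_upI)
    show "\<exists>n. bound \<zero>\<^bsub>P\<^esub> n (embed f)"
      using f by (intro exI[of _ "deg R f"]) (auto simp: bound_def embed_def deg_aboveD)
  qed (use f in \<open>simp add: embed_def\<close>)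
  then show "embed f \<in> carrier Q" and "coeff Q (embed f) n = monom P (coeff P f n) 0"
    by (simp_all add: Q_def UP_def[of P] embed_def)
qed

lemma
  assumes F: "F \<in> carrier Q"
  shows x_coeff_closed: "x_coeff m F \<in> carrier P"
    and coeff_x_coeff: "coeff P (x_coeff m F) n = coeff P (coeff Q F n) m"
proof -
  have "x_coeff m F \<in> up R"
  proof (rule mem_upI)
    show "\<exists>n. bound \<zero> n (x_coeff m F)"
      using F by (intro exI[of _ "deg P F"]) (auto simp: bound_def x_coeff_def Q.deg_aboveD)
  qed (use F in \<open>simp add: x_coeff_def\<close>)
  then show "x_coeff m F \<in> carrier P" and "coeff P (x_coeff m F) n = coeff P (coeff Q F n) m"
    by (simp_all add: P_def UP_def[of R]) (simp add: x_coeff_def P_def UP_def[of R])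
qed

text \<open>
  Taking the coefficient of \<open>x\<^sup>m\<close> is a homomorphism of \<open>R[y]\<close>-bimodules: multiplying by a polynomial
  without \<open>x\<close> does not mix different powers of \<open>x\<close>. As \<open>R\<close> need not be commutative, each side
  requires an argument of its own.
\<close>

lemma x_coeff_embed_mult:
  assumes f: "f \<in> carrier P" and G: "G \<in> carrier Q"
  shows "x_coeff m (embed f \<otimes>\<^bsub>Q\<^esub> G) = f \<otimes>\<^bsub>P\<^esub> x_coeff m G"
proof (rule up_eqI)
  fix n
  have "coeff P (x_coeff m (embed f \<otimes>\<^bsub>Q\<^esub> G)) n
      = (\<Oplus>i\<in>{..n}. coeff P (monom P (coeff P f i) 0 \<otimes>\<^bsub>P\<^esub> coeff Q G (n - i)) m)"
    using f G by (simp add: coeff_x_coeff coeff_embed embed_closed coeff_finsum Pi_def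
        del: coeff_mult)
  also have "\<dots> = coeff P (f \<otimes>\<^bsub>P\<^esub> x_coeff m G) n"
    using f G by (simp add: monom_mult_is_smult x_coeff_closed coeff_x_coeff)
  finally show "coeff P (x_coeff m (embed f \<otimes>\<^bsub>Q\<^esub> G)) n = coeff P (f \<otimes>\<^bsub>P\<^esub> x_coeff m G) n" .
qed (use f G in \<open>simp_all add: x_coeff_closed embed_closed\<close>)

lemma x_coeff_mult_embed:
  assumes f: "f \<in> carrier P" and G: "G \<in> carrier Q"
  shows "x_coeff m (G \<otimes>\<^bsub>Q\<^esub> embed f) = x_coeff m G \<otimes>\<^bsub>P\<^esub> f"
proof (rule up_eqI)
  fix n
  have "coeff P (x_coeff m (G \<otimes>\<^bsub>Q\<^esub> embed f)) n
      = (\<Oplus>i\<in>{..n}. coeff P (coeff Q G i \<otimes>\<^bsub>P\<^esub> monom P (coeff P f (n - i)) 0) m)"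
    using f G by (simp add: coeff_x_coeff coeff_embed embed_closed coeff_finsum Pi_def
        del: coeff_mult)
  also have "\<dots> = (\<Oplus>i\<in>{..n}. coeff P (coeff Q G i) m \<otimes> coeff P f (n - i))"
    using f G by (simp add: coeff_mult_monom del: coeff_mult)
  also have "\<dots> = coeff P (x_coeff m G \<otimes>\<^bsub>P\<^esub> f) n"
    using f G by (simp add: x_coeff_closed coeff_x_coeff)
  finally show "coeff P (x_coeff m (G \<otimes>\<^bsub>Q\<^esub> embed f)) n = coeff P (x_coeff m G \<otimes>\<^bsub>P\<^esub> f) n" .
qed (use f G in \<open>simp_all add: x_coeff_closed embed_closed\<close>)

lemma x_coeff_embed_sandwich:
  assumes f: "f \<in> carrier P" and G: "G \<in> carrier Q"
  shows "x_coeff m (embed f \<otimes>\<^bsub>Q\<^esub> G \<otimes>\<^bsub>Q\<^esub> embed f) = f \<otimes>\<^bsub>P\<^esub> x_coeff m G \<otimes>\<^bsub>P\<^esub> f"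
  using f G by (simp add: x_coeff_mult_embed x_coeff_embed_mult embed_closed)

lemma x_coeff_zero: "x_coeff m \<zero>\<^bsub>Q\<^esub> = \<zero>\<^bsub>P\<^esub>"
  by (rule up_eqI) (simp_all add: x_coeff_closed coeff_x_coeff)

lemma x_coeff_embed:
  assumes "f \<in> carrier P"
  shows "x_coeff m (embed f) = (if m = 0 then f else \<zero>\<^bsub>P\<^esub>)"
  using assms by (intro up_eqI) (simp_all add: x_coeff_closed coeff_x_coeff embed_closed coeff_embed)

lemma x_coeff_const:
  assumes "r \<in> carrier P"
  shows "x_coeff m (monom Q r 0) = monom P (coeff P r m) 0"
  using assms by (intro up_eqI) (simp_all add: x_coeff_closed coeff_x_coeff)

lemma eq_zero_if_x_coeffs_zero:
  assumes "F \<in> carrier Q" and "\<And>m. x_coeff m F = \<zero>\<^bsub>P\<^esub>"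
  shows "F = \<zero>\<^bsub>Q\<^esub>"
proof (rule Q.up_eqI)
  fix n
  show "coeff Q F n = coeff Q \<zero>\<^bsub>Q\<^esub> n"
    using assms by (intro up_eqI) (simp_all add: coeff_x_coeff[symmetric])
qed (use assms in simp_all)

theorem inner_McCoy_if_inner_McCoy_UP:
  assumes "inner_McCoy P"
  shows "inner_McCoy R"
  unfolding inner_McCoy_def P_def[symmetric]
proof (intro ballI impI)
  fix f g
  assume "f \<in> carrier P - {\<zero>\<^bsub>P\<^esub>}" and "g \<in> carrier P - {\<zero>\<^bsub>P\<^esub>}"
  then have f: "f \<in> carrier P" "f \<noteq> \<zero>\<^bsub>P\<^esub>" and g: "g \<in> carrier P" "g \<noteq> \<zero>\<^bsub>P\<^esub>"
    by auto
  assume fgf: "f \<otimes>\<^bsub>P\<^esub> g \<otimes>\<^bsub>P\<^esub> f = \<zero>\<^bsub>P\<^esub>"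
  have embed_nonzero: "embed h \<noteq> \<zero>\<^bsub>Q\<^esub>" if "h \<in> carrier P" "h \<noteq> \<zero>\<^bsub>P\<^esub>" for h
    using that x_coeff_embed[of h 0] x_coeff_zero[of 0] by auto
  have "embed f \<in> carrier Q - {\<zero>\<^bsub>Q\<^esub>}" and "embed g \<in> carrier Q - {\<zero>\<^bsub>Q\<^esub>}"
    using f g embed_nonzero by (auto simp: embed_closed)
  moreover have "embed f \<otimes>\<^bsub>Q\<^esub> embed g \<otimes>\<^bsub>Q\<^esub> embed f = \<zero>\<^bsub>Q\<^esub>"
    using f(1) g(1) fgf
    by (intro eq_zero_if_x_coeffs_zero)
      (simp_all add: embed_closed x_coeff_embed_sandwich x_coeff_embed)
  ultimately obtain r where r: "r \<in> carrier P" "r \<noteq> \<zero>\<^bsub>P\<^esub>"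
    and frf: "embed f \<otimes>\<^bsub>Q\<^esub> monom Q r 0 \<otimes>\<^bsub>Q\<^esub> embed f = \<zero>\<^bsub>Q\<^esub>"
    by (rule Q.inner_McCoyE[OF assms])
  obtain m where m: "coeff P r m \<noteq> \<zero>"
    using r up_eqI[of r "\<zero>\<^bsub>P\<^esub>"] by auto
  have "f \<otimes>\<^bsub>P\<^esub> monom P (coeff P r m) 0 \<otimes>\<^bsub>P\<^esub> f
      = x_coeff m (embed f \<otimes>\<^bsub>Q\<^esub> monom Q r 0 \<otimes>\<^bsub>Q\<^esub> embed f)"
    using f(1) r(1) by (simp add: x_coeff_embed_sandwich x_coeff_const)
  then have "f \<otimes>\<^bsub>P\<^esub> monom P (coeff P r m) 0 \<otimes>\<^bsub>P\<^esub> f = \<zero>\<^bsub>P\<^esub>"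
    by (simp add: frf x_coeff_zero)
  then show "\<exists>r\<in>carrier R - {\<zero>}. f \<otimes>\<^bsub>P\<^esub> monom P r 0 \<otimes>\<^bsub>P\<^esub> f = \<zero>\<^bsub>P\<^esub>"
    using r(1) m by (intro bexI[of _ "coeff P r m"]) auto
qed

end

theorem theorem5p1:
  fixes R :: "('a, 'm) ring_scheme"
  assumes "ring R"
  shows "inner_McCoy R \<longleftrightarrow> inner_McCoy (UP R)"
proof -
  interpret ring R by fact
  interpret UP_UP_ring R "UP R" "UP (UP R)"
    by unfold_locales
  show ?thesis
    using inner_McCoy_UP_if_inner_McCoy inner_McCoy_if_inner_McCoy_UP by blast
qed

end
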